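(* Let $m,n,M$ be the library size, the number of users and the cache size per user (in files), respectively, in a single-hop wireless D2D caching network with transmission range $r\le\sqrt2$, and divide the network into clusters of $g_{\rm c}$ users each. Let $t_{\rm c}=\frac{g_{\rm c}M}{m}$ and suppose $t_{\rm c}\ge2$, $c(t_{\rm c}-1)=\frac mM-1$, and $\frac mM,t_{\rm c},c\in\mathbb{Z}^+$. Then the per-user throughput $$T_{\rm c}^{\rm hc}(M)=\frac{C_r}{\mathcal{K}}\,\frac{M}{m-M}\,\frac{t_{\rm c}-1}{t_{\rm c}}$$ is achievable with each file split into $$K=K_{\rm c}^{\rm hc}=\left(\frac mM\right)^{t_{\rm c}}$$ packets, where $C_r$ is the link rate and $\mathcal{K}$ is the reuse factor.
   Context: Network. $n$ users lie on a uniform grid in the unit square. A library of $m\ge n$ independent files of $F$ bits (entropy $F$) each is given. Each user has a cache of $MF$ bits and requests one file; demands are arbitrary (users request distinct files). Protocol model. A transmission from user $u$ to user $v$ succeeds iff the distance between $u$ and $v$ is at most $r$ and $v$ is at distance at least $(1+\Delta)r$ from every other simultaneously transmitting user ($\Delta>0$ fixed). A successful link carries a constant $C_r$ bits per channel use. Clustering. The users are divided, by proximity, into clusters of equal size $g_{\rm c}$; the range $r$ is such that a transmission by a user can be received by all users of its own cluster. Users receive messages only from users of their own cluster. The reuse factor $\mathcal{K}$ is the number of sets into which the clusters are partitioned so that all clusters of the same set can be simultaneously active (one transmitting user per cluster, received by the whole cluster) without violating the protocol model. Scheme with $K$ packets per file. Each file is split into $K$ equal packets. In the placement phase (independent of demands)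 each user stores $MK$ of the $mK$ packets. In the delivery phase each user transmits a message depending only on its stored packets and the demands, made of codewords that are bitwise XORs of packets it stores. Each user must decode its requested file from the received messages and its cache, with worst-case (over demands and users) error probability that can be made arbitrarily small as $F\to\infty$. The transmission rate of a cluster is the total number of bits transmitted by its users divided by $F$. Throughput. The per-user throughput is $T=F/D$, where $D$ is the number of channel uses required to satisfy all user requests in the network; $T$ is achievable if there is such a scheme together with a schedule of active links respecting the protocol model that delivers all transmitted messages to their destinations in $D\le F/T$ channel uses. *)

theory Defs
  imports "HOL-Probability.Probability"
begin

text \<open>Users are the numbers below \<open>users N\<close>; the protocol model uses the guard
  factor \<open>guard N\<close> (the \<open>\<Delta>\<close> of the literature), and \<open>link_rate N\<close> is in bits per
  channel use.\<close>

record network =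
  users :: nat
  position :: "nat \<Rightarrow> real \<times> real"
  tx_range :: real
  guard :: real
  link_rate :: real

text \<open>A uniform grid consists of all points of some square lattice that fall in the unit
  square; the spacing and the offset of the lattice are not prescribed.  Distances on
  \<open>real \<times> real\<close> are Euclidean.\<close>

definition uniform_grid :: "nat \<Rightarrow> (nat \<Rightarrow> real \<times> real) \<Rightarrow> bool" where
  "uniform_grid n pos \<longleftrightarrow>
     (\<exists>x0 y0 \<delta>. \<delta> > 0 \<and>
        bij_betw pos {..<n}
          (({0..1} \<times> {0..1}) \<inter>
           {(x0 + \<delta> * of_int i, y0 + \<delta> * of_int j) | i j :: int. True}))"

definition d2d_network :: "network \<Rightarrow> bool" where
  "d2d_network N \<longleftrightarrow>
     users N > 0 \<and> uniform_grid (users N) (position N) \<and>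
     tx_range N > 0 \<and> guard N > 0 \<and> link_rate N > 0"

definition link_succeeds :: "network \<Rightarrow> nat set \<Rightarrow> nat \<Rightarrow> nat \<Rightarrow> bool" where
  "link_succeeds N A u v \<longleftrightarrow>
     dist (position N u) (position N v) \<le> tx_range N \<and>
     (\<forall>w \<in> A - {u}. dist (position N w) (position N v) \<ge> (1 + guard N) * tx_range N)"

definition clustering :: "network \<Rightarrow> nat \<Rightarrow> nat set set \<Rightarrow> bool" where
  "clustering N g \<C> \<longleftrightarrow>
     partition_on {..<users N} \<C> \<and>
     (\<forall>C \<in> \<C>. card C = g \<and>
        (\<forall>u \<in> C. \<forall>v \<in> C. dist (position N u) (position N v) \<le> tx_range N))"

definition cluster_of :: "nat set set \<Rightarrow> nat \<Rightarrow> nat set" where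
  "cluster_of \<C> u = (THE C. C \<in> \<C> \<and> u \<in> C)"

text \<open>With \<open>A\<close> the set of simultaneous transmitters, every transmission reaches the whole
  cluster of its transmitter.  If clusters have at least two members this forces at most one
  transmitter per cluster, because a transmitter is at distance 0 from itself.\<close>

definition protocol_ok :: "network \<Rightarrow> nat set set \<Rightarrow> nat set \<Rightarrow> bool" where
  "protocol_ok N \<C> A \<longleftrightarrow>
     (\<forall>u \<in> A. \<forall>v \<in> cluster_of \<C> u - {u}. link_succeeds N A u v)"

text \<open>The reuse factor is the number of classes of such a partition of the clusters: in each
  class one arbitrary user per cluster may transmit.\<close>

definition reuse_partition :: "network \<Rightarrow> nat set set \<Rightarrow> nat set set set \<Rightarrow> bool" where
  "reuse_partition N \<C> \<P> \<longleftrightarrow>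
     partition_on \<C> \<P> \<and>
     (\<forall>\<S> \<in> \<P>. \<forall>tx. (\<forall>C \<in> \<S>. tx C \<in> C) \<longrightarrow> protocol_ok N \<C> (tx ` \<S>))"


text \<open>Independent files of \<open>F\<close> bits with entropy \<open>F\<close> are independent and uniformly
  distributed, i.e. the library as a whole is uniform on this set.\<close>

definition libraries :: "nat \<Rightarrow> nat \<Rightarrow> (nat \<Rightarrow> bool list) set" where
  "libraries m F = {..<m} \<rightarrow>\<^sub>E {w. length w = F}"

definition demands :: "nat \<Rightarrow> nat \<Rightarrow> (nat \<Rightarrow> nat) set" where
  "demands n m = {d \<in> {..<n} \<rightarrow>\<^sub>E {..<m}. inj_on d {..<n}}"

text \<open>A packet is identified by a pair of a file and an index below \<open>K\<close>; the definition is
  meant for \<open>K dvd F\<close>.\<close>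

definition packet :: "nat \<Rightarrow> nat \<Rightarrow> (nat \<Rightarrow> bool list) \<Rightarrow> nat \<times> nat \<Rightarrow> bool list" where
  "packet F K W p = take (F div K) (drop (snd p * (F div K)) (W (fst p)))"

text \<open>A bit of the XOR of a finite set of packets is set iff it is set in an odd number of
  them.\<close>

definition xor_packets ::
  "nat \<Rightarrow> nat \<Rightarrow> (nat \<Rightarrow> bool list) \<Rightarrow> (nat \<times> nat) set \<Rightarrow> bool list" where
  "xor_packets F K W S = map (\<lambda>i. odd (card {p \<in> S. packet F K W p ! i})) [0..<F div K]"

text \<open>\<open>cache u\<close> is the set of packets stored by \<open>u\<close>; \<open>codewords d u\<close> lists, for each codeword
  sent by \<open>u\<close> under the demands \<open>d\<close>, the packets that are XORed; \<open>decoder d u\<close> maps the stored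
  packets of \<open>u\<close> and the messages received (indexed by their senders) to an estimate of the
  requested file.\<close>

record caching_scheme =
  cache :: "nat \<Rightarrow> (nat \<times> nat) set"
  codewords :: "(nat \<Rightarrow> nat) \<Rightarrow> nat \<Rightarrow> (nat \<times> nat) set list"
  decoder :: "(nat \<Rightarrow> nat) \<Rightarrow> nat \<Rightarrow> (nat \<times> nat \<Rightarrow> bool list) \<Rightarrow> (nat \<Rightarrow> bool list list)
                \<Rightarrow> bool list"

definition valid_scheme :: "nat \<Rightarrow> nat \<Rightarrow> real \<Rightarrow> nat \<Rightarrow> caching_scheme \<Rightarrow> bool" where
  "valid_scheme n m M K S \<longleftrightarrow>
     (\<forall>u < n. cache S u \<subseteq> {..<m} \<times> {..<K} \<and> real (card (cache S u)) = M * real K) \<and>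
     (\<forall>d \<in> demands n m. \<forall>u < n. \<forall>X \<in> set (codewords S d u). X \<subseteq> cache S u)"

definition message ::
  "nat \<Rightarrow> nat \<Rightarrow> caching_scheme \<Rightarrow> (nat \<Rightarrow> nat) \<Rightarrow> (nat \<Rightarrow> bool list) \<Rightarrow> nat \<Rightarrow> bool list list" where
  "message F K S d W u = map (xor_packets F K W) (codewords S d u)"

definition message_bits :: "nat \<Rightarrow> nat \<Rightarrow> caching_scheme \<Rightarrow> (nat \<Rightarrow> nat) \<Rightarrow> nat \<Rightarrow> nat" where
  "message_bits F K S d u = length (codewords S d u) * (F div K)"

definition decoded_file ::
  "nat set set \<Rightarrow> nat \<Rightarrow> nat \<Rightarrow> caching_scheme \<Rightarrow> (nat \<Rightarrow> nat) \<Rightarrow> (nat \<Rightarrow> bool list) \<Rightarrow> nat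
     \<Rightarrow> bool list" where
  "decoded_file \<C> F K S d W u =
     decoder S d u
       (restrict (packet F K W) (cache S u))
       (restrict (message F K S d W) (cluster_of \<C> u - {u}))"

definition error_prob ::
  "nat set set \<Rightarrow> nat \<Rightarrow> nat \<Rightarrow> nat \<Rightarrow> caching_scheme \<Rightarrow> (nat \<Rightarrow> nat) \<Rightarrow> nat \<Rightarrow> real" where
  "error_prob \<C> m F K S d u =
     measure_pmf.prob (pmf_of_set (libraries m F)) {W. decoded_file \<C> F K S d W u \<noteq> W (d u)}"


text \<open>A schedule is a sequence of phases, each given by its set of transmitters and its length
  in channel uses.  Lengths are real numbers, since \<open>link_rate N\<close> is an arbitrary real:
  sending \<open>b\<close> bits takes \<open>b / link_rate N\<close> channel uses, without rounding.\<close>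

type_synonym schedule = "(nat set \<times> real) list"

definition valid_schedule :: "network \<Rightarrow> nat set set \<Rightarrow> schedule \<Rightarrow> bool" where
  "valid_schedule N \<C> \<sigma> \<longleftrightarrow>
     (\<forall>(A, \<tau>) \<in> set \<sigma>. A \<subseteq> {..<users N} \<and> \<tau> \<ge> 0 \<and> protocol_ok N \<C> A)"

definition channel_uses :: "schedule \<Rightarrow> real" where
  "channel_uses \<sigma> = (\<Sum>(A, \<tau>) \<leftarrow> \<sigma>. \<tau>)"

definition bits_sent :: "network \<Rightarrow> schedule \<Rightarrow> nat \<Rightarrow> real" where
  "bits_sent N \<sigma> u = (\<Sum>(A, \<tau>) \<leftarrow> \<sigma>. if u \<in> A then link_rate N * \<tau> else 0)"

definition delivers ::
  "network \<Rightarrow> nat set set \<Rightarrow> nat \<Rightarrow> nat \<Rightarrow> caching_scheme \<Rightarrow> (nat \<Rightarrow> nat) \<Rightarrow> schedule \<Rightarrow> bool" where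
  "delivers N \<C> F K S d \<sigma> \<longleftrightarrow>
     valid_schedule N \<C> \<sigma> \<and>
     (\<forall>u < users N. real (message_bits F K S d u) \<le> bits_sent N \<sigma> u)"

text \<open>Achievability of the per-user throughput \<open>T\<close> with \<open>m\<close> files, caches of \<open>M\<close> files and \<open>K\<close>
  packets per file.  Splitting into equal packets restricts the file size to multiples of
  \<open>K\<close>.\<close>

definition achievable ::
  "network \<Rightarrow> nat set set \<Rightarrow> nat \<Rightarrow> real \<Rightarrow> nat \<Rightarrow> real \<Rightarrow> bool" where
  "achievable N \<C> m M K T \<longleftrightarrow>
     (\<forall>\<epsilon> > 0. \<exists>F0. \<forall>F \<ge> F0. K dvd F \<longrightarrow>
        (\<exists>S. valid_scheme (users N) m M K S \<and>
           (\<forall>d \<in> demands (users N) m.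
              (\<forall>u < users N. error_prob \<C> m F K S d u \<le> \<epsilon>) \<and>
              (\<exists>\<sigma>. delivers N \<C> F K S d \<sigma> \<and> channel_uses \<sigma> \<le> real F / T))))"

end

theory Submission
  imports Defs
begin

text \<open>Put \<open>q = m / M\<close>, so that \<open>g = q t\<close> and \<open>q - 1 = c (t - 1)\<close>.  Arrange the users of a
  cluster as the pairs \<open>(i, a)\<close> of a dimension \<open>i < t\<close> and a value \<open>a < q\<close>, and index the packets
  of a file by the points of the hypercube \<open>{..<q}\<^sup>t\<close>; user \<open>(i, a)\<close> stores the points whose
  \<open>i\<close>-th coordinate is \<open>a\<close>.  A point \<open>A\<close> selects one user \<open>(i, A i)\<close> per dimension, and each of
  these users misses \<open>q - 1 = c (t - 1)\<close> points on the line through \<open>A\<close> in its own direction, all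
  of which the other \<open>t - 1\<close> selected users store.  These points are shared out, \<open>c\<close> to each of
  the other users, and the \<open>j\<close>-th selected user sends \<open>c\<close> XORs, each of one point for every
  \<open>i \<noteq> j\<close>.  Hence every user sends \<open>c q\<^sup>t\<^sup>-\<^sup>1\<close> codewords, and the users of a cluster
  transmit in turn, one reuse class after the other.\<close>

section \<open>Decoding\<close>

lemma length_library:
  assumes "W \<in> libraries m F" "f < m"
  shows "length (W f) = F"
  using assms by (auto simp: libraries_def PiE_def Pi_def)

lemma length_packet:
  assumes W: "W \<in> libraries m F" and p: "p \<in> {..<m} \<times> {..<K}" and "K dvd F"
  shows "length (packet F K W p) = F div K"
proof -
  obtain f k where p': "p = (f, k)" "f < m" "k < K"
    using p by auto
  \<comment> \<open>Packet \<open>k\<close> ends at bit \<open>Suc k * (F div K)\<close>, at most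
    \<open>F\<close>, so \<open>take\<close> finds enough bits.\<close>
  have "Suc k * (F div K) \<le> K * (F div K)"
    using p'(3) by (intro mult_right_mono) auto
  also have "\<dots> = F"
    using \<open>K dvd F\<close> by simp
  finally show ?thesis
    using p' length_library[OF W] by (simp add: packet_def)
qed

text \<open>Bit \<open>i\<close> of a file is bit \<open>i mod L\<close> of its packet
  \<open>i div L\<close>, where \<open>L\<close> is the packet length, so the \<open>K\<close>
  packets cover the file.\<close>

lemma libraries_file_eqI:
  assumes W: "W \<in> libraries m F" "W' \<in> libraries m F" and f: "f < m"
    and K: "K > 0" "K dvd F"
    and eq: "\<And>k. k < K \<Longrightarrow> packet F K W (f, k) = packet F K W' (f, k)"
  shows "W f = W' f"
proof (rule nth_equalityI)
  have len: "length (W f) = F" "length (W' f) = F"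
    using W f by (auto intro: length_library)
  then show "length (W f) = length (W' f)"
    by simp
  fix i assume "i < length (W f)"
  then have i: "i < F"
    using len by simp
  define L where "L = F div K"
  have F: "F = K * L"
    using K by (simp add: L_def)
  have "L > 0"
    using i F by (cases L) auto
  have k: "i div L < K"
    using i F by (simp add: less_mult_imp_div_less)
  have "packet F K V (f, i div L) ! (i mod L) = V f ! i" if "length (V f) = F" for V
  proof -
    have "i div L * L \<le> length (V f)"
      using that i by (meson div_times_less_eq_dividend le_trans less_imp_le_nat)
    then show ?thesis
      using \<open>L > 0\<close> by (simp add: packet_def flip: L_def)
  qed
  then show "W f ! i = W' f ! i"
    using eq[OF k] len by metis
qed

text \<open>At each bit position the parity splits into the bit of \<open>p\<close> and the parity
  of the remaining packets. The latter agree in both libraries, so equal XORs force equal bits of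
  \<open>p\<close>.\<close>

lemma packet_eq_from_xor:
  assumes W: "W \<in> libraries m F" "W' \<in> libraries m F" and "K dvd F"
    and X: "finite X" "p \<in> X" and p: "p \<in> {..<m} \<times> {..<K}"
    and eq: "\<And>p'. p' \<in> X - {p} \<Longrightarrow> packet F K W p' = packet F K W' p'"
    and xor: "xor_packets F K W X = xor_packets F K W' X"
  shows "packet F K W p = packet F K W' p"
proof (rule nth_equalityI)
  have len: "length (packet F K W p) = F div K" "length (packet F K W' p) = F div K"
    using assms by (auto intro: length_packet)
  then show "length (packet F K W p) = length (packet F K W' p)"
    by simp
  fix i assume "i < length (packet F K W p)"
  then have i: "i < F div K"
    using len by simp
  define B where "B V = {p' \<in> X - {p}. packet F K V p' ! i}" for V
  have split: "odd (card {p' \<in> X. packet F K V p' ! i}) \<longleftrightarrow>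
      (packet F K V p ! i \<noteq> odd (card (B V)))" for V
  proof -
    have "{p' \<in> X. packet F K V p' ! i} = (if packet F K V p ! i then insert p (B V) else B V)"
      using X by (auto simp: B_def)
    moreover have "finite (B V)" "p \<notin> B V"
      using X by (auto simp: B_def)
    ultimately show ?thesis
      by auto
  qed
  have "B W = B W'"
    using eq by (auto simp: B_def)
  moreover have "odd (card {p' \<in> X. packet F K W p' ! i}) \<longleftrightarrow>
      odd (card {p' \<in> X. packet F K W' p' ! i})"
    using arg_cong[OF xor, of "\<lambda>l. l ! i"] i by (simp add: xor_packets_def)
  ultimately show "packet F K W p ! i = packet F K W' p ! i"
    using split[of W] split[of W'] by (simp split: if_splits) argo
qed

lemma finite_libraries: "finite (libraries m F)"
proof -
  have "{w :: bool list. length w = F} = {w. set w \<subseteq> UNIV \<and> length w = F}"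
    by simp
  also have "finite \<dots>"
    by (rule finite_lists_length_eq) simp
  finally show ?thesis
    by (auto simp: libraries_def intro: finite_PiE)
qed

lemma libraries_nonempty: "libraries m F \<noteq> {}"
  by (auto simp: libraries_def PiE_eq_empty_iff intro: exI[of _ "replicate F True"])

text \<open>Outputs the requested file of an arbitrary library that explains the observations of the
  user; it is correct as soon as these observations determine the file.\<close>

definition consistent_decoder ::
  "nat set set \<Rightarrow> nat \<Rightarrow> nat \<Rightarrow> nat \<Rightarrow> (nat \<Rightarrow> (nat \<times> nat) set) \<Rightarrow>
     ((nat \<Rightarrow> nat) \<Rightarrow> nat \<Rightarrow> (nat \<times> nat) set list) \<Rightarrow>
     (nat \<Rightarrow> nat) \<Rightarrow> nat \<Rightarrow> (nat \<times> nat \<Rightarrow> bool list) \<Rightarrow> (nat \<Rightarrow> bool list list) \<Rightarrow> bool list" where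
  "consistent_decoder \<C> m F K Z X d u stored received =
     (SOME W. W \<in> libraries m F \<and> restrict (packet F K W) (Z u) = stored \<and>
        restrict (\<lambda>v. map (xor_packets F K W) (X d v)) (cluster_of \<C> u - {u}) = received) (d u)"

text \<open>Two libraries with the same observations agree on every packet of the requested file: it
  is stored, or it is the only packet of a received XOR outside the cache. Hence the error is
  exactly zero.\<close>

lemma error_prob_consistent_decoder:
  assumes K: "K > 0" "K dvd F" and du: "d u < m"
    and decodable: "\<And>k. k < K \<Longrightarrow> (d u, k) \<notin> Z u \<Longrightarrow>
      \<exists>v \<in> cluster_of \<C> u - {u}. \<exists>Y \<in> set (X d v).
        finite Y \<and> (d u, k) \<in> Y \<and> Y - {(d u, k)} \<subseteq> Z u"
  shows "error_prob \<C> m F K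
    \<lparr>cache = Z, codewords = X, decoder = consistent_decoder \<C> m F K Z X\<rparr> d u = 0"
proof -
  let ?S = "\<lparr>cache = Z, codewords = X, decoder = consistent_decoder \<C> m F K Z X\<rparr>"
  have correct: "decoded_file \<C> F K ?S d W u = W (d u)" if W: "W \<in> libraries m F" for W
  proof -
    define explains where "explains W' \<longleftrightarrow> W' \<in> libraries m F \<and>
        restrict (packet F K W') (Z u) = restrict (packet F K W) (Z u) \<and>
        restrict (\<lambda>v. map (xor_packets F K W') (X d v)) (cluster_of \<C> u - {u}) =
        restrict (\<lambda>v. map (xor_packets F K W) (X d v)) (cluster_of \<C> u - {u})" for W'
    define V where "V = (SOME W'. explains W')"
    have "explains V"
      unfolding V_def by (rule someI[of _ W]) (simp add: explains_def W)
    then have V: "V \<in> libraries m F"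
      and stored_eq: "restrict (packet F K V) (Z u) = restrict (packet F K W) (Z u)"
      and received_eq:
        "restrict (\<lambda>v. map (xor_packets F K V) (X d v)) (cluster_of \<C> u - {u}) =
         restrict (\<lambda>v. map (xor_packets F K W) (X d v)) (cluster_of \<C> u - {u})"
      unfolding explains_def by blast+
    have stored: "packet F K V p = packet F K W p" if "p \<in> Z u" for p
      using fun_cong[OF stored_eq, of p] that by simp
    have received: "map (xor_packets F K V) (X d v) = map (xor_packets F K W) (X d v)"
      if "v \<in> cluster_of \<C> u - {u}" for v
      using fun_cong[OF received_eq, of v] that by simp
    have "V (d u) = W (d u)"
    proof (rule libraries_file_eqI[OF V W du K])
      fix k assume k: "k < K"
      show "packet F K V (d u, k) = packet F K W (d u, k)"
      proof (cases "(d u, k) \<in> Z u")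
        case True
        then show ?thesis by (rule stored)
      next
        case False
        then obtain v Y where v: "v \<in> cluster_of \<C> u - {u}"
          and Y: "Y \<in> set (X d v)" "finite Y" "(d u, k) \<in> Y" "Y - {(d u, k)} \<subseteq> Z u"
          using decodable[OF k] by blast
        have "xor_packets F K V Y = xor_packets F K W Y"
          using received[OF v] Y(1) by simp
        then show ?thesis
          using Y k du stored by (intro packet_eq_from_xor[OF V W K(2) Y(2,3)]) auto
      qed
    qed
    moreover have "decoded_file \<C> F K ?S d W u = V (d u)"
      by (simp add: decoded_file_def consistent_decoder_def message_def[abs_def] V_def
          explains_def)
    ultimately show ?thesis by simp
  qed
  \<comment> \<open>Only libraries carry mass; correctness is known for them alone.\<close>
  have "set_pmf (pmf_of_set (libraries m F)) \<inter> {W. decoded_file \<C> F K ?S d W u \<noteq> W (d u)} = {}"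
    using correct finite_libraries libraries_nonempty by auto
  then show ?thesis
    unfolding error_prob_def by (subst measure_pmf_zero_iff)
qed

section \<open>The hypercube scheme\<close>

lemma cluster_of_eq:
  assumes "partition_on A \<C>" "C \<in> \<C>" "u \<in> C"
  shows "cluster_of \<C> u = C"
  unfolding cluster_of_def
  using assms by (intro the_equality) (auto simp: partition_on_def disjoint_def)

text \<open>The coordinates are bijective on each cluster separately, so one placement rule serves
  all clusters. The equation for \<open>q\<close> says that a line of the cube has
  \<open>c * (t - 1)\<close> points besides any given one.\<close>

locale hypercube =
  fixes n m t c q K :: nat and \<C> :: "nat set set" and dim val :: "nat \<Rightarrow> nat"
    and point :: "nat \<Rightarrow> nat \<Rightarrow> nat" and index :: "(nat \<Rightarrow> nat) \<Rightarrow> nat"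
  assumes partition: "partition_on {..<n} \<C>"
    and coords: "\<And>C. C \<in> \<C> \<Longrightarrow> bij_betw (\<lambda>u. (dim u, val u)) C ({..<t} \<times> {..<q})"
    and point: "bij_betw point {..<K} ({..<t} \<rightarrow>\<^sub>E {..<q})"
    and index: "\<And>x. x \<in> {..<t} \<rightarrow>\<^sub>E {..<q} \<Longrightarrow> index x < K \<and> point (index x) = x"
    and q: "q = Suc (c * (t - 1))" and c: "c > 0"
begin

abbreviation cube :: "(nat \<Rightarrow> nat) set" where
  "cube \<equiv> {..<t} \<rightarrow>\<^sub>E {..<q}"

definition slice :: "nat \<Rightarrow> (nat \<Rightarrow> nat) set" where
  "slice u = {x \<in> cube. x (dim u) = val u}"

definition placement :: "nat \<Rightarrow> (nat \<times> nat) set" where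
  "placement u = {..<m} \<times> {k \<in> {..<K}. point k \<in> slice u}"

text \<open>The position of \<open>j\<close> in the increasing enumeration of the dimensions other than \<open>i\<close>.\<close>

definition rank :: "nat \<Rightarrow> nat \<Rightarrow> nat" where
  "rank i j = (if j < i then j else j - 1)"

text \<open>For \<open>A\<close> in \<open>slice v\<close> these are the other \<open>t - 1\<close>
  users of the cluster selected by \<open>A\<close>: the receivers of one codeword.\<close>

definition served :: "(nat \<Rightarrow> nat) \<Rightarrow> nat \<Rightarrow> nat set" where
  "served A v = {u \<in> cluster_of \<C> v. dim u \<noteq> dim v \<and> val u = A (dim u)}"

text \<open>A move of \<open>A\<close> in the direction of the receiver \<open>u\<close>. Over the
  \<open>t - 1\<close> dimensions other than \<open>dim u\<close> and all \<open>s < c\<close>, the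
  number \<open>rank (dim u) (dim v) * c + s\<close> takes each value from \<open>0\<close> to
  \<open>q - 2\<close> once; the added \<open>1\<close> skips the value that \<open>u\<close>
  stores.\<close>

definition part :: "(nat \<Rightarrow> nat) \<Rightarrow> nat \<Rightarrow> nat \<Rightarrow> nat \<Rightarrow> nat \<Rightarrow> nat" where
  "part A v s u = A(dim u := (val u + 1 + (rank (dim u) (dim v) * c + s)) mod q)"

definition codeword :: "(nat \<Rightarrow> nat) \<Rightarrow> nat \<Rightarrow> (nat \<Rightarrow> nat) \<times> nat \<Rightarrow> (nat \<times> nat) set" where
  "codeword d v = (\<lambda>(A, s). (\<lambda>u. (d u, index (part A v s u))) ` served A v)"

text \<open>The list runs over the pairs \<open>(A, s)\<close> rather than over the set of
  codewords, so its length is known even if two pairs give the same codeword.\<close>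

definition delivery :: "(nat \<Rightarrow> nat) \<Rightarrow> nat \<Rightarrow> (nat \<times> nat) set list" where
  "delivery d v = map (codeword d v) (SOME l. distinct l \<and> set l = slice v \<times> {..<c})"

section \<open>Sizes of slices, caches and messages\<close>

lemma user_cluster:
  assumes "u < n"
  obtains C where "C \<in> \<C>" "u \<in> C" "cluster_of \<C> u = C" "C \<subseteq> {..<n}"
proof -
  obtain C where "C \<in> \<C>" "u \<in> C"
    using partition assms by (auto simp: partition_on_def)
  then show thesis
    using that cluster_of_eq[OF partition] partition_onD1[OF partition] by blast
qed

lemma coords_less:
  assumes "u < n"
  shows "dim u < t" "val u < q"
proof -
  obtain C where "C \<in> \<C>" "u \<in> C"
    using assms by (rule user_cluster)
  then have "(dim u, val u) \<in> {..<t} \<times> {..<q}"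
    using coords by (auto simp: bij_betw_def)
  then show "dim u < t" "val u < q" by auto
qed

lemma finite_slice: "finite (slice u)"
  unfolding slice_def by (rule finite_subset[of _ cube]) (auto intro: finite_PiE)

lemma card_slice:
  assumes "u < n"
  shows "card (slice u) = q ^ (t - 1)"
proof -
  note less = coords_less[OF assms]
  have "slice u = Pi\<^sub>E {..<t} (\<lambda>j. if j = dim u then {val u} else {..<q})"
  proof (rule set_eqI)
    fix x
    have "(\<forall>j<t. x j < q) \<and> x (dim u) = val u \<longleftrightarrow>
        (\<forall>j<t. x j \<in> (if j = dim u then {val u} else {..<q}))"
      using less by (metis insertI1 lessThan_iff singletonD)
    then show "x \<in> slice u \<longleftrightarrow> x \<in> Pi\<^sub>E {..<t} (\<lambda>j. if j = dim u then {val u} else {..<q})"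
      unfolding slice_def PiE_iff by blast
  qed
  then have "card (slice u) = (\<Prod>j<t. if j = dim u then 1 else q)"
    by (auto simp: card_PiE intro!: prod.cong)
  also have "\<dots> = (\<Prod>j\<in>{..<t} - {dim u}. q)"
    by (rule prod.mono_neutral_cong_right) auto
  finally show ?thesis
    using less by simp
qed

lemma card_placement:
  assumes "u < n"
  shows "card (placement u) = m * q ^ (t - 1)"
proof -
  have "bij_betw point {k \<in> {..<K}. point k \<in> slice u} (slice u)"
    unfolding bij_betw_def
  proof
    show "inj_on point {k \<in> {..<K}. point k \<in> slice u}"
      using point by (auto simp: bij_betw_def intro: inj_on_subset)
    show "point ` {k \<in> {..<K}. point k \<in> slice u} = slice u"
      using point by (auto simp: bij_betw_def slice_def)
  qed
  then have "card {k \<in> {..<K}. point k \<in> slice u} = q ^ (t - 1)"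
    using bij_betw_same_card card_slice[OF assms] by metis
  then show ?thesis
    by (simp add: placement_def card_cartesian_product)
qed

lemma enumeration:
  "distinct (SOME l. distinct l \<and> set l = slice v \<times> {..<c})"
  "set (SOME l. distinct l \<and> set l = slice v \<times> {..<c}) = slice v \<times> {..<c}"
proof -
  have "\<exists>l. distinct l \<and> set l = slice v \<times> {..<c}"
    using finite_distinct_list[of "slice v \<times> {..<c}"] finite_slice by auto
  from someI_ex[OF this]
  show "distinct (SOME l. distinct l \<and> set l = slice v \<times> {..<c})"
    "set (SOME l. distinct l \<and> set l = slice v \<times> {..<c}) = slice v \<times> {..<c}"
    by auto
qed

lemma set_delivery: "set (delivery d v) = codeword d v ` (slice v \<times> {..<c})"
  by (simp add: delivery_def enumeration)

lemma length_delivery: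
  assumes "v < n"
  shows "length (delivery d v) = q ^ (t - 1) * c"
proof -
  have "length (delivery d v) = card (slice v \<times> {..<c})"
    using distinct_card[OF enumeration(1), of v] by (simp add: delivery_def enumeration(2))
  then show ?thesis
    by (simp add: card_cartesian_product card_slice[OF assms])
qed

section \<open>Codewords: stored by the sender, decodable by the receivers\<close>

lemma part_in_cube:
  assumes "A \<in> cube" "u < n"
  shows "part A v s u \<in> cube"
proof -
  have "q > 0"
    using q by simp
  then show ?thesis
    using assms coords_less[OF assms(2)] by (auto simp: part_def PiE_def Pi_def extensional_def)
qed

text \<open>Moving \<open>A\<close> in direction \<open>dim u\<close> keeps all other coordinates,
  so a user \<open>w\<close> selected by \<open>A\<close> in another dimension stores the resulting
  packet. With the sender as \<open>w\<close>, codewords consist of stored packets; with another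
  receiver as \<open>w\<close>, the interference is known to it.\<close>

lemma part_in_placement:
  assumes "A \<in> cube" "u < n" "w < n" "dim u \<noteq> dim w" "A (dim w) = val w" "d u < m"
  shows "(d u, index (part A v s u)) \<in> placement w"
proof -
  have "part A v s u \<in> slice w"
    using part_in_cube[OF assms(1,2)] assms(4,5) by (simp add: slice_def part_def)
  then show ?thesis
    using index assms(6) by (simp add: placement_def slice_def)
qed

lemma served_subset:
  assumes "v < n"
  shows "served A v \<subseteq> {..<n}"
  by (rule user_cluster[OF assms]) (auto simp: served_def)

lemma codeword_subset_placement:
  assumes "v < n" and d: "d \<in> {..<n} \<rightarrow> {..<m}" and Y: "Y \<in> set (delivery d v)"
  shows "Y \<subseteq> placement v"
proof
  fix p assume "p \<in> Y"
  then obtain A s u where A: "A \<in> slice v" and u: "u \<in> served A v"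
    and p: "p = (d u, index (part A v s u))"
    using Y by (auto simp: set_delivery codeword_def)
  have "u < n"
    using u served_subset[OF \<open>v < n\<close>] by auto
  then show "p \<in> placement v"
    unfolding p using A u d \<open>v < n\<close>
    by (intro part_in_placement) (auto simp: slice_def served_def)
qed

text \<open>To recover \<open>x\<close>, user \<open>u\<close> replaces its own coordinate of \<open>x\<close> by \<open>val u\<close>, which gives
  \<open>A\<close>; the cyclic offset of \<open>x (dim u)\<close> from \<open>val u\<close>, divided by \<open>c\<close>, gives the sender and
  the codeword of the sender.\<close>

lemma decodable:
  assumes "u < n" and d: "d \<in> {..<n} \<rightarrow> {..<m}" and "k < K" and miss: "(d u, k) \<notin> placement u"
  shows "\<exists>v \<in> cluster_of \<C> u - {u}. \<exists>Y \<in> set (delivery d v).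
    finite Y \<and> (d u, k) \<in> Y \<and> Y - {(d u, k)} \<subseteq> placement u"
proof -
  obtain C where C: "C \<in> \<C>" "u \<in> C" "cluster_of \<C> u = C" "C \<subseteq> {..<n}"
    using \<open>u < n\<close> by (rule user_cluster)
  define i a x where "i = dim u" and "a = val u" and "x = point k"
  have i: "i < t" and a: "a < q"
    using coords_less[OF \<open>u < n\<close>] by (auto simp: i_def a_def)
  have x: "x \<in> cube"
    using point \<open>k < K\<close> by (auto simp: x_def bij_betw_def)
  have index_x: "index x = k"
    using point \<open>k < K\<close> index[OF x] by (auto simp: x_def bij_betw_def dest: inj_onD)
  have xi: "x i < q"
    using x i by auto
  have "d u < m"
    using d \<open>u < n\<close> by auto
  then have "x i \<noteq> a"
    using miss \<open>k < K\<close> x by (auto simp: placement_def slice_def i_def a_def x_def)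
  \<comment> \<open>The cyclic offset less one: offset 0 is excluded by
    \<open>x i \<noteq> a\<close>, so \<open>e\<close> ranges over
    \<open>q - 1 = c * (t - 1)\<close> values.\<close>
  define e where "e = (if a < x i then x i - a - 1 else x i + q - a - 1)"
  have e: "e < c * (t - 1)" and xi_eq: "(a + 1 + e) mod q = x i"
    using \<open>x i \<noteq> a\<close> a xi q by (auto simp: e_def mod_if)
  define s r where "s = e mod c" and "r = e div c"
  have s: "s < c" and e_eq: "r * c + s = e"
    using c by (auto simp: s_def r_def)
  have r: "r < t - 1"
    using e by (simp add: r_def less_mult_imp_div_less mult.commute)
  \<comment> \<open>The inverse of \<open>rank i\<close>, which skips the dimension of the
    receiver.\<close>
  define j where "j = (if r < i then r else Suc r)"
  have j: "j < t" "j \<noteq> i" "rank i j = r"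
    using r i by (auto simp: j_def rank_def)
  define A where "A = x(i := a)"
  have A: "A \<in> cube"
    using x i a by (auto simp: A_def PiE_def Pi_def extensional_def)
  have "(j, A j) \<in> (\<lambda>u. (dim u, val u)) ` C"
    using coords[OF C(1)] j A by (auto simp: bij_betw_def)
  then obtain v where v: "v \<in> C" "dim v = j" "val v = A j"
    by auto
  have clv: "cluster_of \<C> v = C"
    using cluster_of_eq[OF partition C(1) v(1)] .
  define Y where "Y = codeword d v (A, s)"
  have Y: "Y \<in> set (delivery d v)"
    using A v s by (auto simp: Y_def set_delivery slice_def)
  have "finite C"
    using C(4) by (rule finite_subset) simp
  then have "finite Y"
    by (simp add: Y_def codeword_def served_def clv)
  have u: "u \<in> served A v"
    using C j v by (auto simp: served_def clv i_def a_def A_def)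
  have "part A v s u = x"
    using xi_eq by (auto simp: part_def v j e_eq A_def simp flip: i_def a_def)
  then have "(d u, k) \<in> Y"
    using u index_x by (force simp: Y_def codeword_def)
  moreover have "Y - {(d u, k)} \<subseteq> placement u"
  proof
    fix p assume p: "p \<in> Y - {(d u, k)}"
    then obtain w where w: "w \<in> served A v" "p = (d w, index (part A v s w))"
      by (auto simp: Y_def codeword_def)
    have "w \<noteq> u"
      using p w \<open>part A v s u = x\<close> index_x by auto
    have "w \<in> C"
      using w clv by (simp add: served_def)
    \<comment> \<open>In each dimension \<open>A\<close> selects only one user of the cluster,
      because the coordinates are injective.\<close>
    have "dim w \<noteq> dim u"
    proof
      assume "dim w = dim u"
      then have "(dim w, val w) = (dim u, val u)"
        using w u by (simp add: served_def)
      then show False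
        using coords[OF C(1)] \<open>w \<in> C\<close> C(2) \<open>w \<noteq> u\<close> by (auto simp: bij_betw_def dest: inj_onD)
    qed
    then show "p \<in> placement u"
      unfolding w(2) using A \<open>w \<in> C\<close> C(4) \<open>u < n\<close> u d
      by (intro part_in_placement) (auto simp: served_def)
  qed
  moreover have "v \<noteq> u"
    using v j by (auto simp: i_def)
  ultimately show ?thesis
    using C(3) v(1) Y \<open>finite Y\<close> by auto
qed

end

section \<open>Scheduling\<close>

lemma sum_list_ge_member:
  fixes f :: "'a \<Rightarrow> real"
  assumes "x \<in> set xs" "\<And>y. y \<in> set xs \<Longrightarrow> f y \<ge> 0"
  shows "f x \<le> (\<Sum>y\<leftarrow>xs. f y)"
proof -
  obtain ys zs where "xs = ys @ x # zs"
    using assms(1) by (auto simp: in_set_conv_decomp)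
  then show ?thesis
    using assms(2) by (auto intro!: add_nonneg_nonneg add_increasing add_increasing2 sum_list_nonneg)
qed

text \<open>Round robin: in every reuse class the clusters give each of their users one turn.\<close>

lemma round_robin_schedule:
  assumes cl: "clustering N g \<C>" and re: "reuse_partition N \<C> \<P>"
    and rate: "link_rate N > 0" and b: "b \<ge> 0"
  obtains \<sigma> where "valid_schedule N \<C> \<sigma>"
    "channel_uses \<sigma> = real (card \<P>) * real g * (b / link_rate N)"
    "\<And>u. u < users N \<Longrightarrow> b \<le> bits_sent N \<sigma> u"
proof -
  have part: "partition_on {..<users N} \<C>" and card: "\<And>C. C \<in> \<C> \<Longrightarrow> card C = g"
    using cl by (auto simp: clustering_def)
  have partP: "partition_on \<C> \<P>"
    using re by (simp add: reuse_partition_def)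
  have sub: "C \<subseteq> {..<users N}" if "C \<in> \<C>" for C
    using that partition_onD1[OF part] by auto
  have "finite \<C>"
    using part by (auto intro: finite_elements)
  then have "finite \<P>"
    using partP by (rule finite_elements)
  then obtain Ps where Ps: "distinct Ps" "set Ps = \<P>"
    using finite_distinct_list by blast
  have "\<exists>e. bij_betw e {..<g} C" if "C \<in> \<C>" for C
    using ex_bij_betw_nat_finite[of C] sub[OF that] card[OF that]
    by (auto simp: atLeast0LessThan intro: finite_subset)
  then obtain e where e: "\<And>C. C \<in> \<C> \<Longrightarrow> bij_betw (e C) {..<g} C"
    by metis
  \<comment> \<open>In phase \<open>(\<S>, k)\<close> the \<open>k\<close>-th user of every cluster
    in the class \<open>\<S>\<close> sends \<open>b\<close> bits.\<close>
  define phase where "phase = (\<lambda>(\<S>, k). ((\<lambda>C. e C k) ` \<S>, b / link_rate N))"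
  define \<sigma> where "\<sigma> = map phase (List.product Ps [0..<g])"
  have in_C: "e C k \<in> C" if "C \<in> \<C>" "k < g" for C k
    using e[OF that(1)] that(2) by (auto simp: bij_betw_def)
  have P_sub: "C \<in> \<C>" if "\<S> \<in> \<P>" "C \<in> \<S>" for \<S> C
    using that partition_onD1[OF partP] by auto
  have "valid_schedule N \<C> \<sigma>"
    unfolding valid_schedule_def
  proof (clarify)
    fix A \<tau> assume "(A, \<tau>) \<in> set \<sigma>"
    then obtain \<S> k where S: "\<S> \<in> \<P>" and k: "k < g" and A: "A = (\<lambda>C. e C k) ` \<S>"
      and \<tau>: "\<tau> = b / link_rate N"
      by (auto simp: \<sigma>_def phase_def Ps)
    have "A \<subseteq> {..<users N}"
      using in_C[OF _ k] P_sub[OF S] sub by (force simp: A)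
    \<comment> \<open>The choice of one transmitter per cluster in \<open>reuse_partition\<close> is
      taken to be \<open>\<lambda>C. e C k\<close>.\<close>
    moreover have "protocol_ok N \<C> A"
      using re S in_C[OF _ k] P_sub[OF S] by (auto simp: A reuse_partition_def)
    ultimately show "A \<subseteq> {..<users N} \<and> \<tau> \<ge> 0 \<and> protocol_ok N \<C> A"
      using rate b \<tau> by simp
  qed
  moreover have "channel_uses \<sigma> = real (card \<P>) * real g * (b / link_rate N)"
  proof -
    have "channel_uses \<sigma> = (\<Sum>_\<leftarrow>List.product Ps [0..<g]. b / link_rate N)"
      by (simp add: channel_uses_def \<sigma>_def phase_def comp_def case_prod_unfold)
    also have "\<dots> = real (length Ps) * real g * (b / link_rate N)"
      by (simp add: sum_list_triv)
    also have "length Ps = card \<P>"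
      using Ps distinct_card by metis
    finally show ?thesis .
  qed
  moreover have "b \<le> bits_sent N \<sigma> u" if u: "u < users N" for u
  proof -
    obtain C where C: "C \<in> \<C>" "u \<in> C"
      using partition_onD1[OF part] u by (metis UnionE lessThan_iff)
    have "u \<in> e C ` {..<g}"
      using bij_betw_imp_surj_on[OF e[OF C(1)]] C(2) by simp
    then obtain k where k: "k < g" "u = e C k"
      by blast
    obtain \<S> where S: "\<S> \<in> \<P>" "C \<in> \<S>"
      using partition_onD1[OF partP] C by (metis UnionE)
    let ?f = "\<lambda>(A, \<tau>). if u \<in> A then link_rate N * \<tau> else 0"
    \<comment> \<open>The single phase in which \<open>u\<close> has its turn already provides
      \<open>b\<close> bits, and no phase contributes negatively.\<close>
    have "?f (phase (\<S>, k)) \<le> (\<Sum>y\<leftarrow>\<sigma>. ?f y)"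
      using S k b rate
      by (intro sum_list_ge_member) (auto simp: \<sigma>_def phase_def Ps)
    moreover have "?f (phase (\<S>, k)) = b"
      using S k rate by (auto simp: phase_def)
    ultimately show ?thesis
      by (simp add: bits_sent_def)
  qed
  ultimately show thesis
    using that by blast
qed

text \<open>Counting suffices: a cluster has \<open>t * q\<close> users and a file
  \<open>q ^ t\<close> packets, so arbitrary bijections give the coordinates.\<close>

lemma hypercube_exists:
  assumes cl: "clustering N g \<C>" and g: "g = t * q" and K: "K = q ^ t"
    and q: "q = Suc (c * (t - 1))" and c: "c > 0"
  obtains dim val point index where "hypercube (users N) t c q K \<C> dim val point index"
proof -
  have part: "partition_on {..<users N} \<C>" and card: "\<And>C. C \<in> \<C> \<Longrightarrow> card C = g"
    using cl by (auto simp: clustering_def)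
  have "\<exists>h. bij_betw h C ({..<t} \<times> {..<q})" if "C \<in> \<C>" for C
  proof (rule finite_same_card_bij)
    show "finite C"
      using partition_onD1[OF part] that by (auto intro: finite_subset[of _ "{..<users N}"])
    show "card C = card ({..<t} \<times> {..<q})"
      using card[OF that] g by (simp add: card_cartesian_product)
  qed simp
  then obtain h where h: "\<And>C. C \<in> \<C> \<Longrightarrow> bij_betw (h C) C ({..<t} \<times> {..<q})"
    by metis
  \<comment> \<open>The bijections of the individual clusters are glued to functions on all
    users.\<close>
  define dim val where "dim u = fst (h (cluster_of \<C> u) u)"
    and "val u = snd (h (cluster_of \<C> u) u)" for u
  have "\<exists>f. bij_betw f {..<K} ({..<t} \<rightarrow>\<^sub>E {..<q})"
    by (rule finite_same_card_bij) (auto simp: K card_PiE intro: finite_PiE)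
  then obtain point where point: "bij_betw point {..<K} ({..<t} \<rightarrow>\<^sub>E {..<q})"
    by blast
  have "hypercube (users N) t c q K \<C> dim val point (inv_into {..<K} point)"
  proof
    show "bij_betw (\<lambda>u. (dim u, val u)) C ({..<t} \<times> {..<q})" if "C \<in> \<C>" for C
      using h[OF that] by (rule bij_betw_cong[THEN iffD1, rotated])
        (simp add: dim_def val_def cluster_of_eq[OF part that])
    show "inv_into {..<K} point x < K \<and> point (inv_into {..<K} point x) = x"
      if "x \<in> {..<t} \<rightarrow>\<^sub>E {..<q}" for x
      using that point inv_into_into[of x point "{..<K}"] f_inv_into_f[of x point "{..<K}"]
      by (auto simp: bij_betw_def)
  qed (use part point q c in auto)
  then show thesis by (rule that)
qed

section \<open>Throughput of the hypercube scheme\<close>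

theorem theorem4:
  fixes N :: network and \<C> :: "nat set set" and \<P> :: "nat set set set"
    and m g t c q \<kappa> K :: nat and M :: real
  assumes "d2d_network N"
    and "tx_range N \<le> sqrt 2"
    and "users N \<le> m"
    and "M > 0"
    and "clustering N g \<C>"
    and "reuse_partition N \<C> \<P>"
    and "\<kappa> = card \<P>"
    and "real t = real g * M / real m"
    and "t \<ge> 2"
    and "real q = real m / M"
    and "q > 0"
    and "c > 0"
    and "real c * (real t - 1) = real m / M - 1"
    and "real K = (real m / M) ^ t"
  shows "achievable N \<C> m M K
           (link_rate N / real \<kappa> * (M / (real m - M)) * ((real t - 1) / real t))"
proof -
  let ?n = "users N" and ?R = "link_rate N"
  have rate: "?R > 0"
    using assms(1) by (simp add: d2d_network_def)
  have m_eq: "real m = real q * M"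
    using assms(4,10) by (simp add: field_simps)
  have "real g = real (t * q)"
    using assms(4,8,11) m_eq by (simp add: field_simps)
  then have g: "g = t * q"
    using of_nat_eq_iff by blast
  have "real K = real (q ^ t)"
    using assms(14) assms(10) by simp
  then have K: "K = q ^ t"
    using of_nat_eq_iff by blast
  have "real q = real (Suc (c * (t - 1)))"
    using assms(9,10,13) by simp
  then have q: "q = Suc (c * (t - 1))"
    using of_nat_eq_iff by blast
  have K_Suc: "K = q * q ^ (t - 1)"
    using K assms(9) by (cases t) auto
  have "K > 0"
    using K assms(11) by simp
  obtain dim val point index
    where "hypercube ?n t c q K \<C> dim val point index"
    using hypercube_exists[OF assms(5) g K q assms(12)] .
  then interpret hypercube ?n m t c q K \<C> dim val point index .
  \<comment> \<open>Only the decoder depends on the file size.\<close>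
  let ?S = "\<lambda>F. \<lparr>cache = placement, codewords = delivery,
    decoder = consistent_decoder \<C> m F K placement delivery\<rparr>"
  have "valid_scheme ?n m M K (?S F)" for F
  proof -
    have "real (card (placement u)) = M * real K" if "u < ?n" for u
      using card_placement[OF that] by (simp add: K_Suc m_eq)
    moreover have "placement u \<subseteq> {..<m} \<times> {..<K}" for u
      by (auto simp: placement_def)
    moreover have "Y \<subseteq> placement u"
      if "d \<in> demands ?n m" "u < ?n" "Y \<in> set (delivery d u)" for d u Y
      using that codeword_subset_placement[of u d Y] by (auto simp: demands_def PiE_def)
    ultimately show ?thesis
      by (auto simp: valid_scheme_def)
  qed
  moreover have "error_prob \<C> m F K (?S F) d u = 0"
    if "K dvd F" "d \<in> demands ?n m" "u < ?n" for F d u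
  proof (rule error_prob_consistent_decoder[OF \<open>K > 0\<close> that(1)])
    have d: "d \<in> {..<?n} \<rightarrow> {..<m}"
      using that(2) by (auto simp: demands_def PiE_def)
    then show "d u < m"
      using that(3) by auto
    show "\<exists>v \<in> cluster_of \<C> u - {u}. \<exists>Y \<in> set (delivery d v).
        finite Y \<and> (d u, k) \<in> Y \<and> Y - {(d u, k)} \<subseteq> placement u"
      if "k < K" "(d u, k) \<notin> placement u" for k
      using decodable[OF \<open>u < ?n\<close> d that] .
  qed
  moreover have "\<exists>\<sigma>. delivers N \<C> F K (?S F) d \<sigma> \<and>
      channel_uses \<sigma> \<le> real F / (?R / real \<kappa> * (M / (real m - M)) * ((real t - 1) / real t))"
    if F: "K dvd F" for F d
  proof -
    \<comment> \<open>The length in bits of the message of each user.\<close>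
    define b where "b = real (q ^ (t - 1) * c * (F div K))"
    obtain \<sigma> where \<sigma>: "valid_schedule N \<C> \<sigma>"
        "channel_uses \<sigma> = real (card \<P>) * real g * (b / ?R)"
        "\<And>u. u < ?n \<Longrightarrow> b \<le> bits_sent N \<sigma> u"
      using round_robin_schedule[OF assms(5,6) rate, of b] by (auto simp: b_def)
    have "delivers N \<C> F K (?S F) d \<sigma>"
      using \<sigma> by (auto simp: delivers_def message_bits_def length_delivery b_def)
    moreover have "channel_uses \<sigma> =
        real F / (?R / real \<kappa> * (M / (real m - M)) * ((real t - 1) / real t))"
    proof -
      \<comment> \<open>The users of a cluster send \<open>t * c * F\<close> bits in total, so the
        transmission rate of a cluster is \<open>t * c\<close>.\<close>
      have "real g * b = real (t * c * (K * (F div K)))"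
        by (simp add: g b_def K_Suc)
      also have "K * (F div K) = F"
        using F by simp
      finally have gb: "real g * b = real t * real c * real F"
        by simp
      \<comment> \<open>The factor \<open>t - 1\<close> of \<open>m / M - 1\<close> cancels, so the
        claimed throughput is the link rate divided by \<open>\<kappa> * c * t\<close>.\<close>
      have "real m - M = M * (real c * (real t - 1))"
        using assms(4,13) by (simp add: field_simps)
      moreover have "real t - 1 > 0"
        using assms(9) by simp
      ultimately have "M / (real m - M) * ((real t - 1) / real t) = 1 / (real c * real t)"
        using assms(4) by simp
      then have "?R / real \<kappa> * (M / (real m - M)) * ((real t - 1) / real t) =
          ?R / real \<kappa> * (1 / (real c * real t))"
        unfolding mult.assoc by (rule arg_cong)
      then show ?thesis
        using \<sigma>(2) gb by (simp add: assms(7) mult.assoc)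
    qed
    ultimately show ?thesis by auto
  qed
  ultimately show ?thesis
    unfolding achievable_def by (metis order_less_imp_le)
qed

end
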